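(* Let $\mathcal{R}$ be a commutative ring with unit, $\mathcal{A}$ an associative commutative $\mathcal{R}$-algebra with unit, and $\mathcal{F}$ a faithful $\mathcal{A}$-module. Let $B:\mathcal{F}\times\mathcal{F}\to\mathcal{F}$ be an $\mathcal{R}$-bilinear form and $\rho:\mathcal{F}\to Der_{\mathcal{R}}(\mathcal{A})$ a morphism of $\mathcal{R}$-modules. Then $(\mathcal{F},B)$ is a left Loday quasi-algebroid with anchor map $\rho$ if and only if the graph $\mathcal{F}_B$ is closed with respect to the bracket $\{\;,\;\}$ on $\mathfrak{gl}(\mathcal{F})\times\mathcal{F}$ and, for all $X,Z\in\mathcal{F}$ and $f\in\mathcal{A}$, $$B(X,f.Z)=f.B(X,Z)+\rho(X)(f).Z.$$
   Context: $\mathcal{F}$ is regarded as an $\mathcal{R}$-module via $\mathcal{R}\to\mathcal{A}$; $f.X$ denotes the $\mathcal{A}$-action. $Der_{\mathcal{R}}(\mathcal{A})$ is the module of $\mathcal{R}$-linear derivations of $\mathcal{A}$. $\mathfrak{gl}(\mathcal{F})=End_{\mathcal{R}}(\mathcal{F})$ with commutator $[\Phi,\Psi]=\Phi\circ\Psi-\Psi\circ\Phi$. The bracket on $\mathfrak{gl}(\mathcal{F})\times\mathcal{F}$ is $\{(\Phi,X),(\Psi,Y)\}=([\Phi,\Psi],\Phi Y)$. Put $ad^L_X(Y)=B(X,Y)$; the graph of $B$ is $\mathcal{F}_B=\{(ad^L_X,X): X\in\mathcal{F}\}$, and closed means that the bracket of any two of its elements lies in it. For $h\in\mathcal{A}$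 let $\mu_h(X)=h.X$. An operator $D\in End_{\mathcal{R}}(\mathcal{F})$ is a quasi-derivation ($D\in QDer_{\mathcal{R}}(\mathcal{F})$) if for each $f\in\mathcal{A}$ there is $g\in\mathcal{A}$ with $[D,\mu_f]=\mu_g$. It is known that, since $\mathcal{F}$ is faithful, $g=\widehat{D}(f)$ is unique and $\widehat{D}\in Der_{\mathcal{R}}(\mathcal{A})$, so $[D,\mu_f]=\mu_{\widehat{D}(f)}$. $(\mathcal{F},B)$ is a left Loday algebra if $B$ is $\mathcal{R}$-bilinear and $B(X,B(Y,Z))=B(B(X,Y),Z)+B(Y,B(X,Z))$ for all $X,Y,Z\in\mathcal{F}$. A left Loday algebra $(\mathcal{F},B)$ is a left Loday quasi-algebroid if $ad^L_X\in QDer_{\mathcal{R}}(\mathcal{F})$ for all $X\in\mathcal{F}$; its anchor map is $X\mapsto \widehat{ad^L_X}\in Der_{\mathcal{R}}(\mathcal{A})$. *)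

theory Defs
  imports "HOL-Algebra.Module"
begin

text \<open>
  Operators on a module are represented by functions that are \<^const>\<open>extensional\<close> on the carrier,
  so that equality of operators is equality of HOL functions. The multiplicative fields of a module
  record play no role in \<^locale>\<open>module\<close>; where a record has to be built they are filled arbitrarily.
\<close>

definition restrict_scalars ::
  "('r, 'a, 'n) module_scheme \<Rightarrow> ('a, 'f, 'k) module_scheme \<Rightarrow> ('r, 'f) module"
  where "restrict_scalars A F =
    \<lparr>carrier = carrier F, mult = mult F, one = one F, zero = zero F, add = add F,
     smult = (\<lambda>r X. (r \<odot>\<^bsub>A\<^esub> \<one>\<^bsub>A\<^esub>) \<odot>\<^bsub>F\<^esub> X)\<rparr>"

definition faithful_module ::
  "('a, 'm) ring_scheme \<Rightarrow> ('a, 'f, 'k) module_scheme \<Rightarrow> bool"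
  where "faithful_module A F \<longleftrightarrow> module A F \<and>
    (\<forall>a\<in>carrier A. (\<forall>X\<in>carrier F. a \<odot>\<^bsub>F\<^esub> X = \<zero>\<^bsub>F\<^esub>) \<longrightarrow> a = \<zero>\<^bsub>A\<^esub>)"

definition mod_hom ::
  "('r, 'm) ring_scheme \<Rightarrow> ('r, 'a, 'n) module_scheme \<Rightarrow> ('r, 'b, 'k) module_scheme \<Rightarrow> ('a \<Rightarrow> 'b) set"
  where "mod_hom R M N = {h \<in> carrier M \<rightarrow> carrier N.
    (\<forall>x\<in>carrier M. \<forall>y\<in>carrier M. h (x \<oplus>\<^bsub>M\<^esub> y) = h x \<oplus>\<^bsub>N\<^esub> h y) \<and>
    (\<forall>r\<in>carrier R. \<forall>x\<in>carrier M. h (r \<odot>\<^bsub>M\<^esub> x) = r \<odot>\<^bsub>N\<^esub> h x)}"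

definition mod_end ::
  "('r, 'm) ring_scheme \<Rightarrow> ('r, 'a, 'n) module_scheme \<Rightarrow> ('a \<Rightarrow> 'a) set"
  where "mod_end R M = mod_hom R M M \<inter> extensional (carrier M)"

definition bilinear_op ::
  "('r, 'm) ring_scheme \<Rightarrow> ('r, 'a, 'n) module_scheme \<Rightarrow> ('a \<Rightarrow> 'a \<Rightarrow> 'a) \<Rightarrow> bool"
  where "bilinear_op R M B \<longleftrightarrow>
    (\<forall>x\<in>carrier M. (\<lambda>y. B x y) \<in> mod_hom R M M) \<and>
    (\<forall>y\<in>carrier M. (\<lambda>x. B x y) \<in> mod_hom R M M)"

definition derivations ::
  "('r, 'm) ring_scheme \<Rightarrow> ('r, 'a, 'n) module_scheme \<Rightarrow> ('a \<Rightarrow> 'a) set"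
  where "derivations R A = {d \<in> mod_end R A.
    \<forall>f\<in>carrier A. \<forall>g\<in>carrier A. d (f \<otimes>\<^bsub>A\<^esub> g) = d f \<otimes>\<^bsub>A\<^esub> g \<oplus>\<^bsub>A\<^esub> f \<otimes>\<^bsub>A\<^esub> d g}"

definition Der ::
  "('r, 'm) ring_scheme \<Rightarrow> ('r, 'a, 'n) module_scheme \<Rightarrow> ('r, 'a \<Rightarrow> 'a) module"
  where "Der R A =
    \<lparr>carrier = derivations R A, mult = undefined, one = undefined,
     zero = (\<lambda>f\<in>carrier A. \<zero>\<^bsub>A\<^esub>),
     add = (\<lambda>d e. \<lambda>f\<in>carrier A. d f \<oplus>\<^bsub>A\<^esub> e f),
     smult = (\<lambda>r d. \<lambda>f\<in>carrier A. r \<odot>\<^bsub>A\<^esub> d f)\<rparr>"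

definition commutator ::
  "('f, 'k) ring_scheme \<Rightarrow> ('f \<Rightarrow> 'f) \<Rightarrow> ('f \<Rightarrow> 'f) \<Rightarrow> 'f \<Rightarrow> 'f"
  where "commutator F \<Phi> \<Psi> = (\<lambda>X\<in>carrier F. \<Phi> (\<Psi> X) \<ominus>\<^bsub>F\<^esub> \<Psi> (\<Phi> X))"

definition gl_bracket ::
  "('f, 'k) ring_scheme \<Rightarrow> ('f \<Rightarrow> 'f) \<times> 'f \<Rightarrow> ('f \<Rightarrow> 'f) \<times> 'f \<Rightarrow> ('f \<Rightarrow> 'f) \<times> 'f"
  where "gl_bracket F = (\<lambda>(\<Phi>, X) (\<Psi>, Y). (commutator F \<Phi> \<Psi>, \<Phi> Y))"

definition closed_under :: "('b \<Rightarrow> 'b \<Rightarrow> 'b) \<Rightarrow> 'b set \<Rightarrow> bool"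
  where "closed_under br S \<longleftrightarrow> (\<forall>u\<in>S. \<forall>v\<in>S. br u v \<in> S)"

definition adL :: "('f, 'k) ring_scheme \<Rightarrow> ('f \<Rightarrow> 'f \<Rightarrow> 'f) \<Rightarrow> 'f \<Rightarrow> 'f \<Rightarrow> 'f"
  where "adL F B X = (\<lambda>Y\<in>carrier F. B X Y)"

definition op_graph :: "('f, 'k) ring_scheme \<Rightarrow> ('f \<Rightarrow> 'f \<Rightarrow> 'f) \<Rightarrow> (('f \<Rightarrow> 'f) \<times> 'f) set"
  where "op_graph F B = {(adL F B X, X) | X. X \<in> carrier F}"

definition mult_op :: "('a, 'f, 'k) module_scheme \<Rightarrow> 'a \<Rightarrow> 'f \<Rightarrow> 'f"
  where "mult_op F h = (\<lambda>X\<in>carrier F. h \<odot>\<^bsub>F\<^esub> X)"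

definition QDer ::
  "('r, 'm) ring_scheme \<Rightarrow> ('r, 'a, 'n) module_scheme \<Rightarrow> ('a, 'f, 'k) module_scheme \<Rightarrow> ('f \<Rightarrow> 'f) set"
  where "QDer R A F = {D \<in> mod_end R (restrict_scalars A F).
    \<forall>f\<in>carrier A. \<exists>g\<in>carrier A. commutator F D (mult_op F f) = mult_op F g}"

definition hat ::
  "('a, 'm) ring_scheme \<Rightarrow> ('a, 'f, 'k) module_scheme \<Rightarrow> ('f \<Rightarrow> 'f) \<Rightarrow> 'a \<Rightarrow> 'a"
  where "hat A F D = (\<lambda>f\<in>carrier A.
    THE g. g \<in> carrier A \<and> commutator F D (mult_op F f) = mult_op F g)"

definition left_Loday_algebra ::
  "('r, 'm) ring_scheme \<Rightarrow> ('r, 'f, 'k) module_scheme \<Rightarrow> ('f \<Rightarrow> 'f \<Rightarrow> 'f) \<Rightarrow> bool"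
  where "left_Loday_algebra R F B \<longleftrightarrow> bilinear_op R F B \<and>
    (\<forall>X\<in>carrier F. \<forall>Y\<in>carrier F. \<forall>Z\<in>carrier F.
      B X (B Y Z) = B (B X Y) Z \<oplus>\<^bsub>F\<^esub> B Y (B X Z))"

definition left_Loday_quasi_algebroid ::
  "('r, 'm) ring_scheme \<Rightarrow> ('r, 'a, 'n) module_scheme \<Rightarrow> ('a, 'f, 'k) module_scheme
    \<Rightarrow> ('f \<Rightarrow> 'f \<Rightarrow> 'f) \<Rightarrow> bool"
  where "left_Loday_quasi_algebroid R A F B \<longleftrightarrow>
    left_Loday_algebra R (restrict_scalars A F) B \<and>
    (\<forall>X\<in>carrier F. adL F B X \<in> QDer R A F)"

definition anchor ::
  "('a, 'm) ring_scheme \<Rightarrow> ('a, 'f, 'k) module_scheme \<Rightarrow> ('f \<Rightarrow> 'f \<Rightarrow> 'f) \<Rightarrow> 'f \<Rightarrow> 'a \<Rightarrow> 'a"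
  where "anchor A F B X = hat A F (adL F B X)"

lemma restrict_scalars_module:
  assumes "algebra R A" "module A F" shows "module R (restrict_scalars A F)"
proof -
  interpret A: algebra R A by fact
  interpret F: module A F by fact
  show ?thesis
  proof (rule moduleI)
    show "cring R" by (rule A.R_cring)
    show "abelian_group (restrict_scalars A F)"
      by (rule abelian_groupI) (auto simp: restrict_scalars_def F.a_ac intro: F.l_neg)
  qed (auto simp: restrict_scalars_def A.smult_l_distr F.smult_l_distr F.smult_r_distr A.smult_assoc1
      A.smult_assoc2 F.smult_assoc1[symmetric])
qed

lemma Der_module:
  assumes "algebra R A" shows "module R (Der R A)"
proof -
  interpret A: algebra R A by fact
  have neg: "\<exists>e\<in>derivations R A. (\<lambda>f\<in>carrier A. e f \<oplus>\<^bsub>A\<^esub> d f) = (\<lambda>f\<in>carrier A. \<zero>\<^bsub>A\<^esub>)"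
    if "d \<in> derivations R A" for d
    by (rule bexI[of _ "\<lambda>f\<in>carrier A. \<ominus>\<^bsub>A\<^esub> d f"])
      (use that in \<open>auto simp: derivations_def mod_end_def mod_hom_def Pi_def A.l_neg A.minus_add
        A.smult_r_minus A.l_minus A.r_minus intro!: restrict_ext\<close>)
  show ?thesis
  proof (rule moduleI)
    show "cring R" by (rule A.R_cring)
    show "abelian_group (Der R A)"
      apply (rule abelian_groupI)
      subgoal by (auto simp: Der_def derivations_def mod_end_def mod_hom_def Pi_def A.a_ac A.smult_r_distr A.l_distr A.r_distr)
      subgoal by (auto simp: Der_def derivations_def mod_end_def mod_hom_def Pi_def)
      subgoal by (auto simp: Der_def derivations_def mod_end_def mod_hom_def Pi_def A.a_ac intro!: restrict_ext)
      subgoal by (auto simp: Der_def derivations_def mod_end_def mod_hom_def Pi_def A.a_ac intro!: restrict_ext)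
      subgoal by (auto simp: Der_def derivations_def mod_end_def mod_hom_def Pi_def intro!: extensionalityI[of _ "carrier A"])
      subgoal using neg by (simp add: Der_def)
      done
  next
    have m: "x \<otimes>\<^bsub>A\<^esub> (a \<odot>\<^bsub>A\<^esub> y) = a \<odot>\<^bsub>A\<^esub> (x \<otimes>\<^bsub>A\<^esub> y)"
      if "a \<in> carrier R" "x \<in> carrier A" "y \<in> carrier A" for a x y
      using that by (metis A.smult_assoc2 A.m_comm A.smult_closed)
    have c: "a \<odot>\<^bsub>A\<^esub> (r \<odot>\<^bsub>A\<^esub> x) = r \<odot>\<^bsub>A\<^esub> (a \<odot>\<^bsub>A\<^esub> x)"
      if "a \<in> carrier R" "r \<in> carrier R" "x \<in> carrier A" for a r x
      using that by (metis A.smult_assoc1 A.R.m_comm)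
    show "a \<odot>\<^bsub>Der R A\<^esub> x \<in> carrier (Der R A)" if "a \<in> carrier R" "x \<in> carrier (Der R A)" for a x
      using that by (auto simp: Der_def derivations_def mod_end_def mod_hom_def Pi_def A.smult_r_distr A.smult_assoc2 m c)
  qed (auto simp: Der_def derivations_def mod_end_def mod_hom_def Pi_def A.smult_l_distr A.smult_r_distr A.smult_assoc1
      intro!: restrict_ext extensionalityI[of _ "carrier A"])
qed

lemma mult_op_inj:
  assumes "faithful_module A F" "g \<in> carrier A" "h \<in> carrier A" "mult_op F g = mult_op F h"
  shows "g = h"
proof -
  interpret F: module A F using assms by (simp add: faithful_module_def)
  have "(g \<ominus>\<^bsub>A\<^esub> h) \<odot>\<^bsub>F\<^esub> X = \<zero>\<^bsub>F\<^esub>" if "X \<in> carrier F" for X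
    using fun_cong[OF assms(4), of X] that assms(2,3)
    by (simp add: mult_op_def a_minus_def F.smult_l_distr F.smult_l_minus F.r_neg)
  then have "g \<ominus>\<^bsub>A\<^esub> h = \<zero>\<^bsub>A\<^esub>" using assms by (auto simp: faithful_module_def)
  then show ?thesis using assms by (metis a_minus_def F.R.add.inv_solve_right F.R.l_zero F.R.zero_closed)
qed

lemma hat_eq:
  assumes "faithful_module A F" "f \<in> carrier A" "g \<in> carrier A"
    "commutator F D (mult_op F f) = mult_op F g"
  shows "hat A F D f = g"
  using assms mult_op_inj[OF assms(1)] unfolding hat_def by (auto intro!: the_equality)

end

theory Submission
  imports Defs
begin

text \<open>
  The first component of the bracket of \<open>(ad\<^sub>X, X)\<close> and \<open>(ad\<^sub>Y, Y)\<close> is \<open>[ad\<^sub>X, ad\<^sub>Y]\<close> and the second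
  is \<open>B(X, Y)\<close>. So the graph is closed iff \<open>[ad\<^sub>X, ad\<^sub>Y] = ad\<^bsub>B(X,Y)\<^esub>\<close>, which evaluated at \<open>Z\<close> is
  the left Loday identity. Likewise the Leibniz rule for \<open>\<rho>\<close> is the operator identity
  \<open>[ad\<^sub>X, \<mu>\<^sub>f] = \<mu>\<^bsub>\<rho>(X)(f)\<^esub>\<close>, which says that \<open>ad\<^sub>X\<close> is a quasi-derivation with
  associated derivation \<open>\<rho>(X)\<close>.
\<close>

lemma restrict_scalars_simps [simp]:
  "carrier (restrict_scalars A F) = carrier F"
  "add (restrict_scalars A F) = add F"
  by (simp_all add: restrict_scalars_def)

lemma (in abelian_group) minus_eq_iff_eq_add:
  assumes "a \<in> carrier G" "b \<in> carrier G" "c \<in> carrier G"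
  shows "a \<ominus> b = c \<longleftrightarrow> a = c \<oplus> b"
  using assms by (metis a_minus_def add.inv_solve_right' add.m_closed)

lemma bilinear_op_closed:
  assumes "bilinear_op R M B" "x \<in> carrier M" "y \<in> carrier M"
  shows "B x y \<in> carrier M"
  using assms by (auto simp: bilinear_op_def mod_hom_def)

text \<open>Both operators are extensional on \<open>carrier F\<close>, so their equality is tested
  pointwise there; the subtracted term then moves to the other side.\<close>

lemma commutator_adL_eq_iff_Loday:
  assumes "abelian_group F"
    and B: "\<And>X Y. X \<in> carrier F \<Longrightarrow> Y \<in> carrier F \<Longrightarrow> B X Y \<in> carrier F"
    and "X \<in> carrier F" "Y \<in> carrier F"
  shows "commutator F (adL F B X) (adL F B Y) = adL F B (B X Y) \<longleftrightarrow>
    (\<forall>Z\<in>carrier F. B X (B Y Z) = B (B X Y) Z \<oplus>\<^bsub>F\<^esub> B Y (B X Z))"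
proof -
  interpret F: abelian_group F by fact
  have "commutator F (adL F B X) (adL F B Y) = adL F B (B X Y) \<longleftrightarrow>
    (\<forall>Z\<in>carrier F. B X (B Y Z) \<ominus>\<^bsub>F\<^esub> B Y (B X Z) = B (B X Y) Z)"
    using assms by (simp add: commutator_def adL_def restrict_def fun_eq_iff B) metis
  then show ?thesis
    using assms by (simp add: F.minus_eq_iff_eq_add B)
qed

text \<open>A pair lies in the graph iff its first component is \<open>adL\<close> of its second,
  and the second component of the bracket is \<open>B X Y\<close>.\<close>

lemma closed_under_op_graph_iff:
  assumes "\<And>X Y. X \<in> carrier F \<Longrightarrow> Y \<in> carrier F \<Longrightarrow> B X Y \<in> carrier F"
  shows "closed_under (gl_bracket F) (op_graph F B) \<longleftrightarrow>
    (\<forall>X\<in>carrier F. \<forall>Y\<in>carrier F. commutator F (adL F B X) (adL F B Y) = adL F B (B X Y))"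
proof -
  have "gl_bracket F (adL F B X, X) (adL F B Y, Y) \<in> op_graph F B \<longleftrightarrow>
      commutator F (adL F B X) (adL F B Y) = adL F B (B X Y)"
    if "X \<in> carrier F" "Y \<in> carrier F" for X Y
    using that assms by (auto simp: gl_bracket_def op_graph_def adL_def)
  then show ?thesis
    by (auto simp: closed_under_def op_graph_def)
qed

text \<open>Pointwise comparison again. The element \<open>g\<close> is left free, to be
  instantiated with \<open>\<rho> X f\<close>.\<close>

lemma commutator_adL_mult_op_eq_iff_Leibniz:
  assumes "module A F"
    and B: "\<And>X Y. X \<in> carrier F \<Longrightarrow> Y \<in> carrier F \<Longrightarrow> B X Y \<in> carrier F"
    and "X \<in> carrier F" "f \<in> carrier A" "g \<in> carrier A"
  shows "commutator F (adL F B X) (mult_op F f) = mult_op F g \<longleftrightarrow>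
    (\<forall>Z\<in>carrier F. B X (f \<odot>\<^bsub>F\<^esub> Z) = f \<odot>\<^bsub>F\<^esub> B X Z \<oplus>\<^bsub>F\<^esub> g \<odot>\<^bsub>F\<^esub> Z)"
proof -
  interpret F: module A F by fact
  have "commutator F (adL F B X) (mult_op F f) = mult_op F g \<longleftrightarrow>
    (\<forall>Z\<in>carrier F. B X (f \<odot>\<^bsub>F\<^esub> Z) \<ominus>\<^bsub>F\<^esub> f \<odot>\<^bsub>F\<^esub> B X Z = g \<odot>\<^bsub>F\<^esub> Z)"
    using assms by (simp add: commutator_def adL_def mult_op_def restrict_def fun_eq_iff B) metis
  then show ?thesis
    using assms by (simp add: F.minus_eq_iff_eq_add B F.a_comm)
qed

lemma adL_mod_end:
  assumes "bilinear_op R (restrict_scalars A F) B" "algebra R A" "module A F" "X \<in> carrier F"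
  shows "adL F B X \<in> mod_end R (restrict_scalars A F)"
proof -
  interpret M: module R "restrict_scalars A F"
    using assms by (intro restrict_scalars_module)
  have "(\<lambda>Y. B X Y) \<in> mod_hom R (restrict_scalars A F) (restrict_scalars A F)"
    using assms by (simp add: bilinear_op_def)
  then show ?thesis
    \<comment> \<open>\<open>adL\<close> agrees with \<open>B X\<close> only on the carrier, so
      linearity transfers once sums and scalar multiples are known to stay there.\<close>
    using M.smult_closed M.a_closed
    by (auto simp: mod_end_def mod_hom_def adL_def)
qed

text \<open>Membership in \<open>QDer\<close> yields some \<open>g\<close>; faithfulness identifies
  it with the value of the definite description in \<open>hat\<close>.\<close>

lemma hat_commutator:
  assumes "faithful_module A F" "D \<in> QDer R A F" "f \<in> carrier A"
  shows "commutator F D (mult_op F f) = mult_op F (hat A F D f)"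
  using assms hat_eq[OF assms(1)] unfolding QDer_def by blast

text \<open>In the backward direction \<open>d f\<close> is the witness for \<open>QDer\<close>, and
  faithfulness makes it the value of \<open>hat\<close>. Extensionality of \<open>d\<close> upgrades
  agreement on \<open>carrier A\<close> to equality of functions.\<close>

lemma QDer_and_hat_eq_iff:
  assumes "faithful_module A F" "D \<in> mod_end R (restrict_scalars A F)"
    and "d \<in> carrier A \<rightarrow> carrier A" "d \<in> extensional (carrier A)"
  shows "D \<in> QDer R A F \<and> hat A F D = d \<longleftrightarrow>
    (\<forall>f\<in>carrier A. commutator F D (mult_op F f) = mult_op F (d f))"
proof
  assume "D \<in> QDer R A F \<and> hat A F D = d"
  then show "\<forall>f\<in>carrier A. commutator F D (mult_op F f) = mult_op F (d f)"
    using hat_commutator[OF assms(1)] by blast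
next
  assume eq: "\<forall>f\<in>carrier A. commutator F D (mult_op F f) = mult_op F (d f)"
  have "D \<in> QDer R A F"
    using assms eq by (auto simp: QDer_def)
  moreover have "hat A F D = d"
  proof (rule extensionalityI[of _ "carrier A"])
    show "hat A F D \<in> extensional (carrier A)" by (simp add: hat_def)
    show "hat A F D f = d f" if "f \<in> carrier A" for f
      using that assms eq by (auto intro!: hat_eq)
  qed (rule assms(4))
  ultimately show "D \<in> QDer R A F \<and> hat A F D = d" ..
qed

theorem theorem5:
  fixes R :: "('r, 'm) ring_scheme"
    and A :: "('r, 'a, 'n) module_scheme"
    and F :: "('a, 'f, 'k) module_scheme"
    and B :: "'f \<Rightarrow> 'f \<Rightarrow> 'f"
    and \<rho> :: "'f \<Rightarrow> 'a \<Rightarrow> 'a"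
  assumes "cring R"
    and "algebra R A"
    and "faithful_module A F"
    and "bilinear_op R (restrict_scalars A F) B"
    and "\<rho> \<in> mod_hom R (restrict_scalars A F) (Der R A)"
  shows "left_Loday_quasi_algebroid R A F B \<and> (\<forall>X\<in>carrier F. anchor A F B X = \<rho> X)
    \<longleftrightarrow> closed_under (gl_bracket F) (op_graph F B) \<and>
        (\<forall>X\<in>carrier F. \<forall>Z\<in>carrier F. \<forall>f\<in>carrier A.
          B X (f \<odot>\<^bsub>F\<^esub> Z) = f \<odot>\<^bsub>F\<^esub> B X Z \<oplus>\<^bsub>F\<^esub> \<rho> X f \<odot>\<^bsub>F\<^esub> Z)"
proof -
  have mod: "module A F"
    using assms(3) by (simp add: faithful_module_def)
  interpret F: module A F by (rule mod)
  have B: "B X Y \<in> carrier F" if "X \<in> carrier F" "Y \<in> carrier F" for X Y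
    using bilinear_op_closed[OF assms(4)] that by simp
  have \<rho>: "\<rho> X \<in> carrier A \<rightarrow> carrier A" "\<rho> X \<in> extensional (carrier A)" if "X \<in> carrier F" for X
    using assms(5) that by (auto simp: mod_hom_def Der_def derivations_def mod_end_def)
  \<comment> \<open>Bilinearity is given, so only the Loday identity remains to be compared with
    closedness.\<close>
  have Loday: "left_Loday_algebra R (restrict_scalars A F) B \<longleftrightarrow>
      closed_under (gl_bracket F) (op_graph F B)"
    using assms(4)
    by (simp add: left_Loday_algebra_def closed_under_op_graph_iff B
        commutator_adL_eq_iff_Loday F.abelian_group_axioms)
  \<comment> \<open>For fixed \<open>X\<close>, being a quasi-derivation and having the prescribed
    anchor are treated jointly, with \<open>d\<close> taken as \<open>\<rho> X\<close>.\<close>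
  have "adL F B X \<in> QDer R A F \<and> anchor A F B X = \<rho> X \<longleftrightarrow>
      (\<forall>f\<in>carrier A. \<forall>Z\<in>carrier F.
        B X (f \<odot>\<^bsub>F\<^esub> Z) = f \<odot>\<^bsub>F\<^esub> B X Z \<oplus>\<^bsub>F\<^esub> \<rho> X f \<odot>\<^bsub>F\<^esub> Z)"
    if "X \<in> carrier F" for X
    unfolding anchor_def
      QDer_and_hat_eq_iff[OF assms(3) adL_mod_end[OF assms(4,2) mod that] \<rho>[OF that]]
    using \<rho>(1)[OF that] that
    by (intro ball_cong refl commutator_adL_mult_op_eq_iff_Leibniz[OF mod B]) auto
  then show ?thesis
    unfolding left_Loday_quasi_algebroid_def Loday by blast
qed

end
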